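(* Let $G$ be a connected graph with $\mathrm{diam}(G)\geq 4$. Then $\kappa(G;K_{1,2})$ is well-defined, i.e., $G$ has a $K_{1,2}$-structure-cut. Moreover, the condition is optimal in the following sense: there exists a connected graph of diameter $3$ that has no $K_{1,2}$-structure-cut.
   Context: All graphs are finite, simple and undirected. $K_{1,2}$ is the path on three vertices (two edges). A graph is trivial if it has exactly one vertex. $\mathrm{diam}(G)$ is the maximum distance between two vertices of $G$. A $K_{1,2}$-structure-cut of a connected graph $G$ is a set $\mathcal{F}$ of pairwise vertex-disjoint subgraphs of $G$ (not necessarily induced), each isomorphic to $K_{1,2}$, such that $G-V(\mathcal{F})$ (the graph obtained by deleting all vertices of all members of $\mathcal{F}$) is disconnected or trivial. The $K_{1,2}$-structure-connectivity $\kappa(G;K_{1,2})$ is the minimum cardinality of a $K_{1,2}$-structure-cut of $G$; it is called well-defined if $G$ has at least one $K_{1,2}$-structure-cut. *)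

theory Defs
  imports "Graph_Theory.Graph_Theory"
begin

text \<open>
  Finite simple undirected graphs are the members of the locale \<^locale>\<open>graph\<close>: finite, symmetric,
  loop-free digraphs without parallel arcs.  An undirected edge is a pair of opposite arcs, and the
  undirected subgraphs of \<open>G\<close> are the subgraphs (in the sense of \<^const>\<open>subgraph\<close>, not necessarily
  induced) that are themselves graphs.
\<close>

text \<open>Every arc has weight 1, so the shortest-path cost is the usual distance (an \<^typ>\<open>ereal\<close>).\<close>

definition graph_dist :: "('a,'b) pre_digraph \<Rightarrow> 'a \<Rightarrow> 'a \<Rightarrow> ereal" where
  "graph_dist G u v = wf_digraph.\<mu> G (\<lambda>_. 1) u v"

definition graph_diam :: "('a,'b) pre_digraph \<Rightarrow> ereal" where
  "graph_diam G = Max {graph_dist G u v | u v. u \<in> verts G \<and> v \<in> verts G}"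

definition trivial_graph :: "('a,'b) pre_digraph \<Rightarrow> bool" where
  "trivial_graph G \<longleftrightarrow> card (verts G) = 1"

text \<open>
  \<^const>\<open>Digraph_Component.connected\<close> is false for the graph without vertices.  That graph is not
  disconnected either (nor is it trivial), so deleting all vertices does not give a structure-cut.
  In the 6-cycle, for instance, any two disjoint 3-vertex paths cover all vertices.
\<close>

definition disconnected_graph :: "('a,'b) pre_digraph \<Rightarrow> bool" where
  "disconnected_graph G \<longleftrightarrow> verts G \<noteq> {} \<and> \<not> Digraph_Component.connected G"

text \<open>
  \<open>K\<^bsub>1,2\<^esub> H\<close> is \<^const>\<open>complete_bipartite_digraph\<close>: it says that \<open>H\<close> is a \<^locale>\<open>graph\<close> isomorphic
  to the path on three vertices.
\<close>

definition K12_structure_cut ::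
    "('a,'b) pre_digraph \<Rightarrow> ('a,'b) pre_digraph set \<Rightarrow> bool" where
  "K12_structure_cut G F \<longleftrightarrow>
     (\<forall>H\<in>F. subgraph H G \<and> K\<^bsub>1,2\<^esub> H) \<and>
     pairwise (\<lambda>H H'. disjnt (verts H) (verts H')) F \<and>
     (let R = G \<restriction> (verts G - (\<Union>H\<in>F. verts H)) in
        disconnected_graph R \<or> trivial_graph R)"

text \<open>The number below is meaningful only if it is well-defined, i.e. if a cut exists.\<close>

definition K12_structure_connectivity :: "('a,'b) pre_digraph \<Rightarrow> nat" where
  "K12_structure_connectivity G = (LEAST k. \<exists>F. K12_structure_cut G F \<and> card F = k)"

definition K12_structure_connectivity_well_defined :: "('a,'b) pre_digraph \<Rightarrow> bool" where
  "K12_structure_connectivity_well_defined G \<longleftrightarrow> (\<exists>F. K12_structure_cut G F)"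

end

theory Submission
  imports Defs
begin

text \<open>
  Suppose first that \<open>u\<close> and \<open>v\<close> are two vertices at distance at least 4.  Take a family of disjoint
  3-vertex paths of \<open>G - u - v\<close> that is maximal, so that the vertices it leaves over in
  \<open>G - u - v\<close> contain no further 3-vertex path (\<open>maximal_K12_packing\<close>).  Then the family is a
  structure-cut: \<open>u\<close> and \<open>v\<close> survive its deletion, and a path joining them in what is left would
  have length at least 4, hence three consecutive inner vertices, and those would form such a further
  3-vertex path (\<open>cut_between_distant_vertices\<close>).

  The 6-cycle has diameter 3 and no structure-cut.  Each of its 3-vertex paths covers a segment of
  three consecutive vertices, and the complement of such a segment is again one.  So a family of
  disjoint 3-vertex paths leaves the whole cycle, a segment or nothing
  (\<open>uncovered_vertices_C6\<close>).  The first two are connected with more than one vertex, and the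
  graph without vertices counts neither as disconnected nor as trivial.
\<close>

section \<open>Walks, distance and connectedness\<close>

lemma (in wf_digraph) induce_subgraph_symmetric:
  assumes "symmetric G"
  shows "symmetric (G \<restriction> S)"
  using assms by (fastforce simp: symmetric_conv)

lemma arcs_ends_induce_subgraph:
  "x \<rightarrow>\<^bsub>G \<restriction> S\<^esub> y \<longleftrightarrow> x \<in> S \<and> y \<in> S \<and> x \<rightarrow>\<^bsub>G\<^esub> y"
  by (auto simp: arcs_ends_conv)

lemma (in wf_digraph) awalk_cost_unit: "awalk_cost (\<lambda>_. 1) p = real (length p)"
  by (induction p) auto

lemma (in wf_digraph) awalk_along_sequence:
  assumes "f 0 \<in> verts G" and "\<And>i. i < k \<Longrightarrow> f i \<rightarrow>\<^bsub>G\<^esub> f (Suc i)"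
  shows "\<exists>p. awalk (f 0) p (f k) \<and> length p = k"
  using assms(2)
proof (induction k)
  case 0
  show ?case
    using assms(1) by (auto simp: awalk_Nil_iff)
next
  case (Suc k)
  then obtain p where p: "awalk (f 0) p (f k)" "length p = k"
    by auto
  obtain e where e: "e \<in> arcs G" "tail G e = f k" "head G e = f (Suc k)"
    using Suc.prems[of k] by (auto simp: arcs_ends_conv)
  have "awalk (f k) [e] (f (Suc k))"
    using e tail_in_verts[of e] by (simp add: awalk_def)
  with p have "awalk (f 0) (p @ [e]) (f (Suc k))"
    by (blast intro: awalk_appendI)
  with p(2) show ?case
    by (intro exI[of _ "p @ [e]"]) simp
qed

lemma graph_dist_le_sequence:
  assumes "wf_digraph G" and "f 0 \<in> verts G" and "\<And>i. i < k \<Longrightarrow> f i \<rightarrow>\<^bsub>G\<^esub> f (Suc i)"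
  shows "graph_dist G (f 0) (f k) \<le> real k"
proof -
  interpret wf_digraph G by fact
  obtain p where p: "awalk (f 0) p (f k)" "length p = k"
    using awalk_along_sequence[of f k] assms by auto
  have "\<mu> (\<lambda>_. 1) (f 0) (f k) \<le> awalk_cost (\<lambda>_. 1) p"
    by (rule min_cost_le_walk_cost) (rule p)
  with p(2) show ?thesis
    by (simp add: graph_dist_def awalk_cost_unit)
qed

text \<open>
  A function that grows by at most 1 along every arc certifies a lower bound on the distance.
\<close>

lemma graph_dist_ge_potential:
  fixes g :: "'a \<Rightarrow> nat"
  assumes "wf_digraph G" and g: "\<And>x y. x \<rightarrow>\<^bsub>G\<^esub> y \<Longrightarrow> g y \<le> Suc (g x)"
    and k: "g v = g u + k"
  shows "real k \<le> graph_dist G u v"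
proof -
  interpret wf_digraph G by fact
  have bound: "g w \<le> g x + length p" if "awalk x p w" for x p w
    using that
  proof (induction p arbitrary: x)
    case Nil
    then show ?case
      by (simp add: awalk_Nil_iff)
  next
    case (Cons e p)
    then have "x \<rightarrow>\<^bsub>G\<^esub> head G e" and "awalk (head G e) p w"
      by (auto simp: awalk_Cons_iff in_arcs_imp_in_arcs_ends)
    with g[of x "head G e"] Cons.IH[of "head G e"] show ?case
      by simp
  qed
  have "real k \<le> awalk_cost (\<lambda>_. 1) p" if "awalk u p v" for p
    using bound[OF that] k by (simp add: awalk_cost_unit)
  then show ?thesis
    unfolding graph_dist_def \<mu>_def by (intro INF_greatest) simp
qed

lemma connected_if_sequence:
  assumes "wf_digraph G" and "symmetric G" and verts: "verts G = f ` {..k}"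
    and step: "\<And>i. i < k \<Longrightarrow> f i \<rightarrow>\<^bsub>G\<^esub> f (Suc i)"
  shows "Digraph_Component.connected G"
proof -
  interpret wf_digraph G by fact
  have from0: "f 0 \<rightarrow>\<^sup>*\<^bsub>G\<^esub> f i" if "i \<le> k" for i
    using awalk_along_sequence[of f i] step that verts by (auto simp: reachable_awalk)
  have "x \<rightarrow>\<^sup>*\<^bsub>G\<^esub> y" if "x \<in> verts G" "y \<in> verts G" for x y
  proof -
    have "f 0 \<rightarrow>\<^sup>*\<^bsub>G\<^esub> x" "f 0 \<rightarrow>\<^sup>*\<^bsub>G\<^esub> y"
      using from0 that by (auto simp: verts)
    then show ?thesis
      using symmetric_reachable[OF \<open>symmetric G\<close>] reachable_trans by blast
  qed
  then show ?thesis
    using verts by (intro connectedI reachable_mk_symmetricI) auto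
qed

section \<open>Families of disjoint 3-vertex paths\<close>

definition K12_packing :: "('a,'b) pre_digraph \<Rightarrow> ('a,'b) pre_digraph set \<Rightarrow> bool" where
  "K12_packing G F \<longleftrightarrow>
     (\<forall>H\<in>F. subgraph H G \<and> K\<^bsub>1,2\<^esub> H) \<and> pairwise (\<lambda>H H'. disjnt (verts H) (verts H')) F"

text \<open>
  The outer vertices \<open>x\<close> and \<open>z\<close> may be adjacent in \<open>G\<close>, so the subgraph is not the induced one: it keeps
  only the arcs at \<open>y\<close>.
\<close>

lemma K12_subgraph_on_path:
  assumes "graph G" and xy: "x \<rightarrow>\<^bsub>G\<^esub> y" and yz: "y \<rightarrow>\<^bsub>G\<^esub> z" and "x \<noteq> z"
  shows "\<exists>H. subgraph H G \<and> K\<^bsub>1,2\<^esub> H \<and> verts H = {x,y,z}"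
proof -
  interpret graph G by fact
  define E where "E = {y} \<times> {x,z} \<union> {x,z} \<times> {y}"
  define H where "H = \<lparr> verts = {x,y,z}, arcs = {e \<in> arcs G. (tail G e, head G e) \<in> E},
    tail = tail G, head = head G \<rparr>"
  have neq: "x \<noteq> y" "y \<noteq> z"
    using xy yz adj_not_same by auto
  have V: "{x,y,z} \<subseteq> verts G"
    using xy yz adj_in_verts by blast
  have "(y,x) \<in> arcs_ends G" "(z,y) \<in> arcs_ends G"
    using xy yz graph_symmetric by auto
  with xy yz have E: "E \<subseteq> arcs_ends G"
    by (auto simp: E_def)
  then have ends: "arcs_ends H = E"
    by (auto simp: H_def arcs_ends_conv)
  have "wf_digraph H"
    by unfold_locales (auto simp: H_def E_def)
  then have sub: "subgraph H G"
    using V by (auto simp: subgraph_def H_def compatible_def intro: wf_digraph)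
  then interpret H: digraph H
    by (rule digraph_subgraph)
  have "symmetric H"
    by (auto simp: symmetric_def ends E_def intro: symI)
  then have "graph H"
    by (rule H.graphI)
  then have "K\<^bsub>1,2\<^esub> H"
    unfolding complete_bipartite_digraph_def ends E_def using neq \<open>x \<noteq> z\<close>
    by (intro conjI exI[of _ "{y}"] exI[of _ "{x,z}"]) (auto simp: H_def)
  with sub show ?thesis
    by (intro exI[of _ H]) (simp add: H_def)
qed

lemma K12_path_vertices:
  assumes "K\<^bsub>1,2\<^esub> H"
  obtains x y z where "verts H = {x,y,z}" "x \<noteq> z" "x \<rightarrow>\<^bsub>H\<^esub> y" "y \<rightarrow>\<^bsub>H\<^esub> z"
proof -
  obtain U V where UV: "verts H = U \<union> V" "card U = 1" "card V = 2"
      "arcs_ends H = U \<times> V \<union> V \<times> U"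
    using assms by (auto simp: complete_bipartite_digraph_def)
  obtain y where "U = {y}"
    using UV(2) by (auto simp: card_1_singleton_iff)
  moreover obtain x z where "V = {x,z}" "x \<noteq> z"
    using UV(3) by (auto simp: card_2_iff)
  ultimately show ?thesis
    using UV by (intro that[of x y z]) auto
qed

text \<open>
  A family covering as many vertices of \<open>S\<close> as possible cannot be extended.
\<close>

lemma maximal_K12_packing:
  assumes "graph G" and "S \<subseteq> verts G"
  obtains F where "K12_packing G F" "(\<Union>H\<in>F. verts H) \<subseteq> S"
    "\<And>x y z. {x,y,z} \<subseteq> S - (\<Union>H\<in>F. verts H) \<Longrightarrow> x \<rightarrow>\<^bsub>G\<^esub> y \<Longrightarrow> y \<rightarrow>\<^bsub>G\<^esub> z \<Longrightarrow> x = z"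
proof -
  interpret graph G by fact
  define P where "P F \<longleftrightarrow> K12_packing G F \<and> (\<Union>H\<in>F. verts H) \<subseteq> S" for F
  define covered where "covered F = card (\<Union>H\<in>F. verts H)" for F :: "('a,'b) pre_digraph set"
  have fin: "finite S"
    using assms(2) finite_verts by (rule finite_subset)
  have "P {}"
    by (simp add: P_def K12_packing_def)
  moreover have "\<forall>F. P F \<longrightarrow> covered F < Suc (card S)"
    unfolding P_def covered_def using card_mono[OF fin] by (auto simp: less_Suc_eq_le)
  ultimately obtain F where F: "P F" and max: "\<And>F'. P F' \<Longrightarrow> covered F' \<le> covered F"
    using ex_has_greatest_nat[of P "{}" covered "Suc (card S)"] by blast
  have "x = z" if xyz: "{x,y,z} \<subseteq> S - (\<Union>H\<in>F. verts H)" and xy: "x \<rightarrow>\<^bsub>G\<^esub> y" and yz: "y \<rightarrow>\<^bsub>G\<^esub> z" for x y z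
  proof (rule ccontr)
    assume "x \<noteq> z"
    then obtain H where H: "subgraph H G" "K\<^bsub>1,2\<^esub> H" "verts H = {x,y,z}"
      using K12_subgraph_on_path[OF \<open>graph G\<close> xy yz] by auto
    have "pairwise (\<lambda>H H'. disjnt (verts H) (verts H')) (insert H F)"
      using F xyz by (auto simp: P_def K12_packing_def pairwise_insert H(3) disjnt_def)
    then have P': "P (insert H F)"
      using F H(1,2) xyz by (simp add: P_def K12_packing_def H(3))
    have "(\<Union>H\<in>F. verts H) \<subset> (\<Union>H\<in>insert H F. verts H)"
      using xyz by (auto simp: H(3))
    moreover have "finite (\<Union>H\<in>insert H F. verts H)"
      using P' fin by (auto simp: P_def intro: finite_subset)
    ultimately have "covered F < covered (insert H F)"
      unfolding covered_def by (rule psubset_card_mono[rotated])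
    with max[OF P'] show False
      by simp
  qed
  moreover have "K12_packing G F" "(\<Union>H\<in>F. verts H) \<subseteq> S"
    using F by (simp_all add: P_def)
  ultimately show thesis
    using that by presburger
qed

section \<open>Structure-cuts in graphs of diameter at least 4\<close>

text \<open>
  Distance 4 is what makes the packing of \<open>G - u - v\<close> separate \<open>u\<close> from \<open>v\<close>: the vertices of a path from
  \<open>u\<close> to \<open>v\<close> other than its ends then number at least three.
\<close>

lemma cut_between_distant_vertices:
  assumes "graph G" and "u \<in> verts G" "v \<in> verts G" and dist: "4 \<le> graph_dist G u v"
  shows "\<exists>F. K12_structure_cut G F"
proof -
  interpret graph G by fact
  define S where "S = verts G - {u,v}"
  have S: "S \<subseteq> verts G"
    by (auto simp: S_def)
  obtain F where F: "K12_packing G F" "(\<Union>H\<in>F. verts H) \<subseteq> S"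
    and max: "\<And>x y z. {x,y,z} \<subseteq> S - (\<Union>H\<in>F. verts H) \<Longrightarrow> x \<rightarrow>\<^bsub>G\<^esub> y \<Longrightarrow> y \<rightarrow>\<^bsub>G\<^esub> z \<Longrightarrow> x = z"
    by (rule maximal_K12_packing[OF \<open>graph G\<close> S]) (rule that)
  define W where "W = verts G - (\<Union>H\<in>F. verts H)"
  define R where "R = G \<restriction> W"
  have R: "verts R = W" "tail R = tail G" "head R = head G"
    by (simp_all add: R_def)
  have uvW: "u \<in> W" "v \<in> W"
    using F(2) assms(2,3) by (auto simp: W_def S_def)
  have sub: "subgraph R G"
    unfolding R_def by (rule subgraph_induce_subgraphI) (auto simp: W_def)
  have "wf_digraph R"
    using sub by auto
  then interpret R: wf_digraph R .
  have "\<not> Digraph_Component.connected R"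
  proof
    assume "Digraph_Component.connected R"
    moreover have "symmetric R"
      unfolding R_def by (rule induce_subgraph_symmetric) (rule sym_arcs)
    ultimately have "strongly_connected R"
      by (intro R.symmetric_connected_imp_strongly_connected)
    then have "u \<rightarrow>\<^sup>*\<^bsub>R\<^esub> v"
      using uvW by (auto simp: strongly_connected_def R_def)
    then obtain p where p: "R.apath u p v"
      by (auto simp: R.reachable_apath)
    then have "awalk u p v"
      using subgraph_awalk_imp_awalk[OF _ sub] by (simp add: R.apath_def)
    then have "\<mu> (\<lambda>_. 1) u v \<le> ereal (awalk_cost (\<lambda>_. 1) p)"
      by (rule min_cost_le_walk_cost)
    with dist have "4 \<le> ereal (real (length p))"
      unfolding graph_dist_def awalk_cost_unit by (rule order_trans)
    then have "4 \<le> length p"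
      by simp
    then obtain a b c d q where pq: "p = a # b # c # d # q"
      by (auto simp: numeral_eq_Suc Suc_le_length_iff)
    \<comment> \<open>The first three inner vertices; the path goes on along \<open>d\<close>, so \<open>v\<close> is not among them.\<close>
    define x y z where "x = head G a" and "y = head G b" and "z = head G c"
    have walk: "R.awalk u p v" and distinct: "distinct (R.awalk_verts u p)"
      using p by (auto simp: R.apath_def)
    have arcs: "a \<in> arcs R" "b \<in> arcs R" "c \<in> arcs R"
      and tails: "tail G a = u" "tail G b = x" "tail G c = y" "tail G d = z"
      and q: "R.awalk (head G d) q v"
      using walk by (auto simp: pq R.awalk_Cons_iff x_def y_def z_def R)
    have "v \<in> set (R.awalk_verts (head G d) q)"
      using last_in_set[OF R.awalk_verts_non_Nil] R.awalk_conv q by metis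
    then have neq: "x \<noteq> u" "x \<noteq> v" "y \<noteq> u" "y \<noteq> v" "z \<noteq> u" "z \<noteq> v" "x \<noteq> z"
      using distinct tails by (auto simp: pq R)
    have "{x,y,z} \<subseteq> W"
      using arcs R.head_in_verts by (auto simp: x_def y_def z_def R)
    then have "{x,y,z} \<subseteq> S - (\<Union>H\<in>F. verts H)"
      using neq by (auto simp: W_def S_def)
    moreover have "x \<rightarrow>\<^bsub>G\<^esub> y" "y \<rightarrow>\<^bsub>G\<^esub> z"
      using arcs tails in_arcs_imp_in_arcs_ends[of b] in_arcs_imp_in_arcs_ends[of c]
      by (simp_all add: R_def y_def z_def)
    ultimately show False
      using max[of x y z] \<open>x \<noteq> z\<close> by simp
  qed
  moreover have "verts R \<noteq> {}"
    using uvW by (auto simp: R_def)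
  ultimately show ?thesis
    using F(1) unfolding K12_structure_cut_def K12_packing_def disconnected_graph_def R_def W_def
    by (auto simp: Let_def)
qed

lemma diameter_attained:
  assumes "fin_digraph G" and "verts G \<noteq> {}"
  shows "\<exists>u\<in>verts G. \<exists>v\<in>verts G. graph_diam G = graph_dist G u v"
proof -
  interpret fin_digraph G by fact
  have D: "{graph_dist G u v | u v. u \<in> verts G \<and> v \<in> verts G} =
      (\<lambda>(u,v). graph_dist G u v) ` (verts G \<times> verts G)" (is "?D = _")
    by auto
  have "finite ?D" and "?D \<noteq> {}"
    using assms(2) unfolding D by auto
  then have "graph_diam G \<in> ?D"
    unfolding graph_diam_def by (rule Max_in)
  then show ?thesis
    by auto
qed

section \<open>The 6-cycle\<close>

definition C6 :: "(nat, nat \<times> nat) pre_digraph" where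
  "C6 = \<lparr> verts = {..<6}, arcs = {(i,j). i < 6 \<and> j < 6 \<and> (j = Suc i mod 6 \<or> i = Suc j mod 6)},
    tail = fst, head = snd \<rparr>"

text \<open>
  The segments are the vertex sets of the 3-vertex paths of the 6-cycle; \<open>i\<close> is the end from which
  the path runs upwards, and matters only modulo 6.
\<close>

definition segment :: "nat \<Rightarrow> nat set" where
  "segment i = (\<lambda>t. (i + t) mod 6) ` {..2}"

lemma segment_eq: "segment i = {i mod 6, (i + 1) mod 6, (i + 2) mod 6}"
  by (auto simp: segment_def numeral_2_eq_2 atMost_Suc)

lemma lessThan_6: "{..<6::nat} = {0,1,2,3,4,5}"
  by auto

lemma verts_C6: "verts C6 = {..<6}"
  by (simp add: C6_def)

lemma adj_C6: "i \<rightarrow>\<^bsub>C6\<^esub> j \<longleftrightarrow> i < 6 \<and> j < 6 \<and> (j = Suc i mod 6 \<or> i = Suc j mod 6)"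
  by (auto simp: C6_def arcs_ends_conv)

lemma adj_C6_successor: "((i + t) mod 6) \<rightarrow>\<^bsub>C6\<^esub> ((i + Suc t) mod 6)"
  by (simp add: adj_C6 mod_Suc_eq)

lemma graph_C6: "graph C6"
proof -
  have fin: "finite (arcs C6)"
    by (rule finite_subset[of _ "{..<6} \<times> {..<6}"]) (auto simp: C6_def)
  have no_loop: "Suc i mod 6 \<noteq> i" if "i < 6" for i :: nat
    using that by (auto simp: mod_Suc)
  have "symmetric C6"
    unfolding symmetric_def by (rule symI) (auto simp: adj_C6)
  moreover have "digraph C6"
  proof
    show "finite (verts C6)" "finite (arcs C6)"
      using fin by (auto simp: C6_def)
    show "tail C6 e \<noteq> head C6 e" if "e \<in> arcs C6" for e
      using that no_loop by (fastforce simp: C6_def)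
  qed (auto simp: C6_def arc_to_ends_def)
  ultimately show ?thesis
    by (intro digraph.graphI)
qed

interpretation C6: graph C6
  by (rule graph_C6)

lemma connected_C6: "Digraph_Component.connected C6"
proof (rule connected_if_sequence)
  show "verts C6 = (\<lambda>t. (0 + t) mod 6) ` {..5}"
    by (force simp: verts_C6)
qed (rule C6.wf_digraph C6.sym_arcs adj_C6_successor)+

lemma connected_segment: "Digraph_Component.connected (C6 \<restriction> segment i)"
proof (rule connected_if_sequence)
  show "wf_digraph (C6 \<restriction> segment i)" "symmetric (C6 \<restriction> segment i)"
    by (auto intro: C6.induce_subgraph_symmetric)
  show "verts (C6 \<restriction> segment i) = (\<lambda>t. (i + t) mod 6) ` {..2}"
    by (simp add: segment_def)
  show "((i + t) mod 6) \<rightarrow>\<^bsub>C6 \<restriction> segment i\<^esub> ((i + Suc t) mod 6)" if "t < 2" for t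
    unfolding arcs_ends_induce_subgraph segment_def
    using that adj_C6_successor[of i t] by (intro conjI imageI) auto
qed

text \<open>
  For the lower bound the potential is the distance from the vertex 0, which is 3 at the antipode.
\<close>

lemma diameter_C6: "graph_diam C6 = 3"
proof -
  have fin: "finite {graph_dist C6 u v | u v. u \<in> verts C6 \<and> v \<in> verts C6}"
    by (rule finite_image_set2) auto
  have le3: "graph_dist C6 u v \<le> 3" if "u < 6" "v < 6" for u v
  proof -
    \<comment> \<open>One of the two ways around the cycle has length at most 3.\<close>
    have "(\<exists>t\<le>3. v = (u + t) mod 6) \<or> (\<exists>t\<le>3. u = (v + t) mod 6)"
    proof (cases "u \<le> v")
      case True
      show ?thesis
      proof (cases "v - u \<le> 3")
        case far: False
        then show ?thesis
          using that True by (intro disjI2 exI[of _ "u + 6 - v"]) simp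
      qed (use that True in \<open>auto intro!: exI[of _ "v - u"]\<close>)
    next
      case False
      show ?thesis
      proof (cases "u - v \<le> 3")
        case far: False
        then show ?thesis
          using that False by (intro disjI1 exI[of _ "v + 6 - u"]) simp
      qed (use that False in \<open>auto intro!: exI[of _ "u - v"]\<close>)
    qed
    then obtain t where "t \<le> 3" and t: "v = (u + t) mod 6 \<or> u = (v + t) mod 6"
      by blast
    have "graph_dist C6 u v \<le> real t"
      using t
    proof
      assume "v = (u + t) mod 6"
      then show ?thesis
        using graph_dist_le_sequence[of C6 "\<lambda>s. (u + s) mod 6" t] that adj_C6_successor
          C6.wf_digraph by (simp add: verts_C6)
    next
      assume u: "u = (v + t) mod 6"
      have "((v + (t - s)) mod 6) \<rightarrow>\<^bsub>C6\<^esub> ((v + (t - Suc s)) mod 6)" if "s < t" for s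
        using C6.graph_symmetric[OF adj_C6_successor[of v "t - Suc s"]] that
        by (simp add: Suc_diff_Suc)
      then show ?thesis
        using graph_dist_le_sequence[of C6 "\<lambda>s. (v + (t - s)) mod 6" t] that u
          C6.wf_digraph by (simp add: verts_C6)
    qed
    also have "ereal (real t) \<le> 3"
      using \<open>t \<le> 3\<close> by simp
    finally show ?thesis .
  qed
  have "real 3 \<le> graph_dist C6 0 3"
  proof (rule graph_dist_ge_potential[where g = "\<lambda>i. min i (6 - i)"])
    show "min y (6 - y) \<le> Suc (min x (6 - x))" if "x \<rightarrow>\<^bsub>C6\<^esub> y" for x y
    proof -
      have "\<forall>x\<in>{..<6}. \<forall>y\<in>{..<6}. y = Suc x mod 6 \<or> x = Suc y mod 6 \<longrightarrow>
          min y (6 - y) \<le> Suc (min x (6 - x))"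
        unfolding lessThan_6 by simp
      with that show ?thesis
        by (auto simp: adj_C6)
    qed
  qed (auto intro: C6.wf_digraph)
  with le3[of 0 3] have "graph_dist C6 0 3 = 3"
    by simp
  then have mem: "3 \<in> {graph_dist C6 u v | u v. u \<in> verts C6 \<and> v \<in> verts C6}"
    by (intro CollectI exI[of _ 0] exI[of _ 3]) (simp add: verts_C6)
  show ?thesis
    unfolding graph_diam_def
    by (rule Max_eqI[OF fin _ mem]) (use le3 in \<open>auto simp: verts_C6\<close>)
qed

lemma complement_segment:
  assumes "i < 6"
  shows "{..<6} - segment i = segment (i + 3)"
  using assms unfolding lessThan_6 lessThan_iff[symmetric]
  by (elim insertE emptyE) (simp_all add: segment_eq, auto)

lemma segment_card: "card (segment i) = 3"
proof -
  have "\<forall>j\<in>{..<6}. card (segment j) = 3"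
    unfolding lessThan_6 by (simp add: segment_eq)
  moreover have "segment i = segment (i mod 6)"
    by (simp add: segment_def mod_add_left_eq)
  ultimately show ?thesis
    by simp
qed

lemma K12_in_C6_is_segment:
  assumes "subgraph H C6" and "K\<^bsub>1,2\<^esub> H"
  shows "\<exists>i<6. verts H = segment i"
proof -
  obtain x y z where xyz: "verts H = {x,y,z}" "x \<noteq> z" "x \<rightarrow>\<^bsub>H\<^esub> y" "y \<rightarrow>\<^bsub>H\<^esub> z"
    using assms(2) by (rule K12_path_vertices)
  then have adj: "x \<rightarrow>\<^bsub>C6\<^esub> y" "y \<rightarrow>\<^bsub>C6\<^esub> z"
    using arcs_ends_mono[OF assms(1)] by auto
  \<comment> \<open>The middle vertex has one neighbour on each side, so \<open>x\<close>, \<open>y\<close>, \<open>z\<close> go around in one direction.\<close>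
  have "(y = (x + 1) mod 6 \<and> z = (x + 2) mod 6) \<or> (y = (z + 1) mod 6 \<and> x = (z + 2) mod 6)"
  proof -
    have "\<forall>x\<in>{..<6}. \<forall>y\<in>{..<6}. \<forall>z\<in>{..<6}. x \<noteq> z \<and>
        (y = Suc x mod 6 \<or> x = Suc y mod 6) \<and> (z = Suc y mod 6 \<or> y = Suc z mod 6) \<longrightarrow>
        (y = (x + 1) mod 6 \<and> z = (x + 2) mod 6) \<or> (y = (z + 1) mod 6 \<and> x = (z + 2) mod 6)"
      unfolding lessThan_6 by simp
    with adj \<open>x \<noteq> z\<close> show ?thesis
      by (simp add: adj_C6)
  qed
  then have "verts H = segment x \<or> verts H = segment z"
    using adj xyz(1) by (auto simp: segment_eq adj_C6)
  then show ?thesis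
    using adj by (auto simp: adj_C6)
qed

lemma uncovered_vertices_C6:
  assumes "K12_packing C6 F"
  shows "verts C6 - (\<Union>H\<in>F. verts H) \<in> {verts C6, {}} \<union> range segment"
proof (cases "F = {}")
  case False
  then obtain H where "H \<in> F"
    by blast
  with assms obtain i where i: "i < 6" "verts H = segment i"
    using K12_in_C6_is_segment unfolding K12_packing_def by blast
  have compl: "verts C6 - verts H = segment (i + 3)"
    using complement_segment i by (simp add: verts_C6)
  show ?thesis
  proof (cases "F = {H}")
    case True
    then show ?thesis
      using compl by simp
  next
    case False
    then obtain H' where H': "H' \<in> F" "H' \<noteq> H"
      using \<open>H \<in> F\<close> by blast
    with assms \<open>H \<in> F\<close> have disj: "verts H \<inter> verts H' = {}" and "subgraph H' C6" "K\<^bsub>1,2\<^esub> H'"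
      by (auto simp: K12_packing_def pairwise_def disjnt_def)
    then obtain j where "verts H' = segment j"
      using K12_in_C6_is_segment by blast
    \<comment> \<open>A second segment disjoint from the first is as large as the complement of the first.\<close>
    moreover have "verts H' \<subseteq> verts C6 - verts H"
      using disj \<open>subgraph H' C6\<close> by auto
    ultimately have "verts H' = verts C6 - verts H"
      unfolding compl by (intro card_subset_eq) (simp_all add: segment_card, simp add: segment_def)
    then have "verts C6 - (\<Union>H\<in>F. verts H) = {}"
      using \<open>H \<in> F\<close> H'(1) by blast
    then show ?thesis
      by simp
  qed
qed simp

lemma no_structure_cut_C6: "\<not> K12_structure_cut C6 F"
proof
  assume cut: "K12_structure_cut C6 F"
  define W where "W = verts C6 - (\<Union>H\<in>F. verts H)"
  have "K12_packing C6 F" and R: "disconnected_graph (C6 \<restriction> W) \<or> trivial_graph (C6 \<restriction> W)"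
    using cut by (auto simp: K12_structure_cut_def K12_packing_def W_def Let_def)
  then consider "W = verts C6" | "W = {}" | i where "W = segment i"
    using uncovered_vertices_C6[of F] by (auto simp: W_def)
  then show False
  proof cases
    case 1
    have "C6 \<restriction> verts C6 = C6"
      by (auto simp: induce_subgraph_def C6_def)
    with 1 R connected_C6 show False
      by (simp add: disconnected_graph_def trivial_graph_def verts_C6)
  next
    case 2
    with R show False
      by (simp add: disconnected_graph_def trivial_graph_def)
  next
    case 3
    with R connected_segment[of i] show False
      by (simp add: disconnected_graph_def trivial_graph_def segment_card)
  qed
qed

section \<open>The diameter condition and its optimality\<close>

theorem theorem3p1:
  shows "(\<forall>G :: ('a,'b) pre_digraph.
            graph G \<and> Digraph_Component.connected G \<and> 4 \<le> graph_diam G \<longrightarrow>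
            K12_structure_connectivity_well_defined G) \<and>
         (\<exists>G :: (nat, nat \<times> nat) pre_digraph.
            graph G \<and> Digraph_Component.connected G \<and> graph_diam G = 3 \<and>
            \<not> (\<exists>F. K12_structure_cut G F))"
proof (intro conjI allI impI)
  fix G :: "('a,'b) pre_digraph"
  assume G: "graph G \<and> Digraph_Component.connected G \<and> 4 \<le> graph_diam G"
  then interpret graph G
    by simp
  have "verts G \<noteq> {}"
    using G by (auto simp: connected_conv)
  with G obtain u v where "u \<in> verts G" "v \<in> verts G" "4 \<le> graph_dist G u v"
    using diameter_attained[OF fin_digraph] by auto
  with G show "K12_structure_connectivity_well_defined G"
    using cut_between_distant_vertices by (auto simp: K12_structure_connectivity_well_defined_def)
next
  show "\<exists>G :: (nat, nat \<times> nat) pre_digraph.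
      graph G \<and> Digraph_Component.connected G \<and> graph_diam G = 3 \<and> \<not> (\<exists>F. K12_structure_cut G F)"
    using graph_C6 connected_C6 diameter_C6 no_structure_cut_C6 by blast
qed

end
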